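(* Assume that the pair of positive random variables $(T_{\mathrm e},T_{\mathrm i})$ has a smooth joint probability density, bounded and everywhere non zero. Then the distribution of $(T_{\mathrm e},T_{\mathrm i})$ is tempered.
   Context: $T_{\mathrm e}$ and $T_{\mathrm i}$ represent the external and internal branch lengths of a rooted tree on three taxa. For $s\in[0,1]$ and $z\in[0,3]$ let $$G(z,s)=\mathbb P\big(e^{-4T_{\mathrm e}}(1-e^{-4T_{\mathrm i}})\le s\,\big|\,e^{-4T_{\mathrm e}}(1+2e^{-4T_{\mathrm i}})=z\big).$$ For $t>0$ let $4q_0=1+3e^{-4t}$, and for every integer $n\ge1$ let $Q_n(t)=\mathbb P(T_{\mathrm i}\le 1/n,\ t\le T_{\mathrm e}\le t+1/n)$. The law of $(T_{\mathrm e},T_{\mathrm i})$ is tempered if the following two conditions hold. (1) For every $t>0$ there exist a real number $s_0\in(0,1]$, an interval $I_t=[4q_0-1-\ell_t,\,4q_0-1+\ell_t]\subset(0,3)$ around $4q_0-1$ (with $\ell_t>0$), an integer $k\ge1$, positive numbers $\alpha,\kappa$, real numbers $0=\varepsilon_0<\varepsilon_1<\dots<\varepsilon_{k-1}\le 2<\varepsilon_k$, and bounded functions $F_0,\dots,F_{k-1}$, such that for every $s\in[0,s_0]$ and every $z\in I_t$, $$\Big|G(z,s)-\sum_{i=0}^{k-1}F_i(z)s^{\alpha+\varepsilon_i}\Big|\le\kappa s^{\alpha+\varepsilon_k}.$$ (2) For every $t>0$, $n^{-1}\log Q_n(t)\to0$ when $n\to\infty$. *)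

theory Defs
  imports "HOL-Probability.Probability"
begin

text \<open>\<open>Ck_on n U f\<close> is meant for open \<open>U\<close>: there it says that \<open>f\<close> is \<open>n\<close> times continuously
  differentiable on \<open>U\<close>.\<close>

primrec Ck_on :: "nat \<Rightarrow> 'a::euclidean_space set \<Rightarrow> ('a \<Rightarrow> real) \<Rightarrow> bool" where
  "Ck_on 0 U f \<longleftrightarrow> continuous_on U f"
| "Ck_on (Suc n) U f \<longleftrightarrow>
     (\<exists>D. (\<forall>x\<in>U. (f has_derivative D x) (at x)) \<and> (\<forall>b\<in>Basis. Ck_on n U (\<lambda>x. D x b)))"

text \<open>Smoothness on an arbitrary subset of a Euclidean space, with the usual convention for sets that
  contain some of their boundary points: \<open>f\<close> is the restriction of a \<open>C\<^sup>\<infinity>\<close> function defined on an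
  open neighbourhood. It is used for densities on the domain \<open>T\<^sub>e > 0, T\<^sub>i \<ge> 0\<close>. The boundary
  \<open>T\<^sub>i = 0\<close> (the star tree) has to be included: a density on the open quadrant that behaves like
  \<open>exp (- 1 / T\<^sub>i)\<close> near it violates the logarithmic condition below. Nothing is needed at \<open>T\<^sub>e = 0\<close>.\<close>

definition smooth_on :: "'a::euclidean_space set \<Rightarrow> ('a \<Rightarrow> real) \<Rightarrow> bool" where
  "smooth_on S f \<longleftrightarrow>
     (\<exists>U g. open U \<and> S \<subseteq> U \<and> (\<forall>n. Ck_on n U g) \<and> (\<forall>x\<in>S. f x = g x))"

text \<open>\<open>K\<close> is a regular conditional distribution of \<open>W\<close> given \<open>Z\<close> under \<open>L\<close>, that is, \<open>K z B\<close> is a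
  version of \<open>P(W \<in> B | Z = z)\<close>.\<close>

definition regular_cond_distr ::
  "'a measure \<Rightarrow> ('a \<Rightarrow> real) \<Rightarrow> ('a \<Rightarrow> real) \<Rightarrow> (real \<Rightarrow> real measure) \<Rightarrow> bool" where
  "regular_cond_distr L W Z K \<longleftrightarrow>
     K \<in> borel \<rightarrow>\<^sub>M prob_algebra borel \<and>
     (\<forall>A\<in>sets borel. \<forall>B\<in>sets borel.
        emeasure L {p \<in> space L. Z p \<in> A \<and> W p \<in> B} =
          (\<integral>\<^sup>+z\<in>A. emeasure (K z) B \<partial>distr L borel Z))"

text \<open>Below, \<open>L\<close> is the joint law of \<open>(T\<^sub>e, T\<^sub>i)\<close>, so that \<open>T\<^sub>e\<close> and \<open>T\<^sub>i\<close> are the two coordinates.\<close>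

definition Wstat :: "real \<times> real \<Rightarrow> real" where
  "Wstat p = exp (- 4 * fst p) * (1 - exp (- 4 * snd p))"

definition Zstat :: "real \<times> real \<Rightarrow> real" where
  "Zstat p = exp (- 4 * fst p) * (1 + 2 * exp (- 4 * snd p))"

definition q0 :: "real \<Rightarrow> real" where
  "q0 t = (1 + 3 * exp (- 4 * t)) / 4"

definition Q :: "(real \<times> real) measure \<Rightarrow> nat \<Rightarrow> real \<Rightarrow> real" where
  "Q L n t = measure L {p \<in> space L. snd p \<le> 1 / real n \<and> t \<le> fst p \<and> fst p \<le> t + 1 / real n}"

definition expansion_condition :: "(real \<Rightarrow> real \<Rightarrow> real) \<Rightarrow> real \<Rightarrow> bool" where
  "expansion_condition G t \<longleftrightarrow>
     (\<exists>(s0::real) (l::real) (k::nat) (\<alpha>::real) (\<kappa>::real) (\<epsilon>::nat \<Rightarrow> real) (F::nat \<Rightarrow> real \<Rightarrow> real).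
        0 < s0 \<and> s0 \<le> 1 \<and>
        0 < l \<and> {4 * q0 t - 1 - l .. 4 * q0 t - 1 + l} \<subseteq> {0<..<3} \<and>
        1 \<le> k \<and> 0 < \<alpha> \<and> 0 < \<kappa> \<and>
        \<epsilon> 0 = 0 \<and> (\<forall>i<k. \<epsilon> i < \<epsilon> (Suc i)) \<and> \<epsilon> (k - 1) \<le> 2 \<and> 2 < \<epsilon> k \<and>
        (\<forall>i<k. bounded (F i ` {4 * q0 t - 1 - l .. 4 * q0 t - 1 + l})) \<and>
        (\<forall>s\<in>{0..s0}. \<forall>z\<in>{4 * q0 t - 1 - l .. 4 * q0 t - 1 + l}.
           \<bar>G z s - (\<Sum>i<k. F i z * s powr (\<alpha> + \<epsilon> i))\<bar> \<le> \<kappa> * s powr (\<alpha> + \<epsilon> k)))"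

text \<open>Conditional probabilities given \<open>Z = z\<close> are only determined for almost every \<open>z\<close>, so the
  condition on \<open>G\<close>, which concerns every \<open>z\<close> in an interval, is read as a condition on a suitable
  version; one version serves all \<open>t\<close>. Since \<open>ln 0 = 0\<close> in HOL, the logarithmic condition states
  separately that \<open>Q\<close> is eventually positive: with \<open>log 0 = -\<infinity>\<close> that is part of the convergence.\<close>

definition tempered :: "(real \<times> real) measure \<Rightarrow> bool" where
  "tempered L \<longleftrightarrow>
     (\<exists>K. regular_cond_distr L Wstat Zstat K \<and>
          (\<forall>t>0. expansion_condition (\<lambda>z s. measure (K z) {..s}) t)) \<and>
     (\<forall>t>0. (\<forall>\<^sub>F n in sequentially. 0 < Q L n t) \<and>
            (\<lambda>n. ln (Q L n t) / real n) \<longlonglongrightarrow> 0)"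

end

theory Submission
  imports Defs "HOL-Real_Asymp.Real_Asymp"
begin

text \<open>
  Write \<open>Z = exp (- 4 Te) (1 + 2 exp (- 4 Ti))\<close> and \<open>W = exp (- 4 Te) (1 - exp (- 4 Ti))\<close>. Both are
  linear in \<open>exp (- 4 Te)\<close> and \<open>exp (- 4 (Te + Ti))\<close>, so \<open>(Te, Ti) \<mapsto> (Z, W)\<close> can be inverted
  explicitly, and \<open>(Z, W)\<close> has the joint density
  \<open>\<rho>(z, w) = f (Te, Ti) \<cdot> 3 / (16 (z + 2w) (z - w))\<close>, taken at the inverse point
  (\<open>distr_stats_density\<close>). Dividing \<open>\<rho>(z, \<cdot>)\<close> by its total mass \<open>H(z)\<close> gives a regular version of the
  law of \<open>W\<close> given \<open>Z = z\<close> (\<open>regular_cond_distr_cond_kernel\<close>), and then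
  \<open>G(z, s) = (1 / H(z)) \<integral>\<^sub>0\<^sup>s \<rho>(z, w) dw\<close>.

  The point \<open>w = 0\<close> corresponds to \<open>Ti = 0\<close>, where \<open>f\<close> is smooth and positive by hypothesis. Hence near
  \<open>(4 q0 - 1, 0)\<close> the function \<open>\<rho>\<close> is, for \<open>w \<ge> 0\<close>, the restriction of a positive function with
  continuous \<open>w\<close>-derivatives of all orders. Taylor's formula of order three in \<open>w\<close>, with bounds that
  are uniform in \<open>z\<close> by compactness, integrates to
  \<open>G(z, s) = F\<^sub>0(z) s + F\<^sub>1(z) s\<^sup>2 + F\<^sub>2(z) s\<^sup>3 + O(s\<^sup>4)\<close>
  (\<open>fibre_integral_expansion\<close>): the expansion condition with \<open>\<alpha> = 1\<close>, \<open>\<epsilon>\<^sub>i = i\<close> and \<open>k = 3\<close>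
  (\<open>expansion_condition_cond_kernel\<close>). Three terms are what \<open>\<epsilon>\<^sub>k > 2\<close> asks for. Positivity of \<open>f\<close> enters through a lower bound of \<open>H\<close>,
  which makes the \<open>F\<^sub>i\<close> bounded.

  The mass \<open>H(z)\<close> may be infinite for \<open>z\<close> in a null set: the factor \<open>1 / (z - w)\<close> is not integrable at
  \<open>w = z\<close>, that is, at \<open>Ti = \<infinity>\<close>. The condition is about every \<open>z\<close>, so on that null set the
  version is chosen to be a point mass at a place that \<open>W\<close> cannot reach, for which all the \<open>F\<^sub>i\<close> vanish.

  For the logarithmic condition, \<open>f\<close> has a positive minimum \<open>c\<close> on \<open>[t, t + 1] \<times> [0, 1]\<close>, so that
  \<open>c / n\<^sup>2 \<le> Q\<^sub>n(t) \<le> 1\<close> (\<open>Q_subexponential\<close>).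
\<close>

section \<open>Change of coordinates\<close>

text \<open>Substitution on the compact intervals \<open>[- n, n]\<close> and their images, followed by monotone convergence.\<close>

lemma nn_integral_exp_substitution:
  fixes \<phi> :: "real \<Rightarrow> ennreal"
  assumes [measurable]: "\<phi> \<in> borel_measurable borel"
  shows "(\<integral>\<^sup>+y. \<phi> y * indicator {0<..} y \<partial>lborel) = (\<integral>\<^sup>+v. \<phi> (exp v) * ennreal (exp v) \<partial>lborel)"
proof -
  define A where "A n = {exp (- real (Suc n))..exp (real (Suc n))}" for n
  define B where "B n = {- real (Suc n)..real (Suc n)}" for n
  have sub: "(\<integral>\<^sup>+y. \<phi> y * indicator (A n) y \<partial>lborel) =
      (\<integral>\<^sup>+v. \<phi> (exp v) * ennreal (exp v) * indicator (B n) v \<partial>lborel)" for n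
    unfolding A_def B_def
    by (rule nn_integral_substitution_aux)
       (auto intro!: derivative_eq_intros continuous_intros)
  have incA: "incseq A" and incB: "incseq B"
    by (auto simp: A_def B_def incseq_def)
  have UnA: "(\<Union>n. A n) = {0<..}"
  proof (intro set_eqI iffI)
    fix y :: real assume "y \<in> {0<..}"
    then have y: "y > 0" by simp
    obtain n where n: "\<bar>ln y\<bar> \<le> real n" using real_arch_simple by blast
    then have "exp (- real (Suc n)) \<le> exp (ln y)" "exp (ln y) \<le> exp (real (Suc n))"
      by (simp_all only: exp_le_cancel_iff)
    with y have "y \<in> A n" by (simp add: A_def)
    then show "y \<in> (\<Union>n. A n)" by blast
  qed (auto simp: A_def intro: less_le_trans[OF exp_gt_zero])
  have UnB: "(\<Union>n. B n) = UNIV"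
  proof (intro set_eqI iffI UNIV_I)
    fix v :: real
    obtain n where n: "\<bar>v\<bar> \<le> real n" using real_arch_simple by blast
    then have "v \<in> B n" by (auto simp: B_def)
    then show "v \<in> (\<Union>n. B n)" by blast
  qed
  have [measurable]: "A n \<in> sets borel" "B n \<in> sets borel" for n
    by (auto simp: A_def B_def)
  have "(\<integral>\<^sup>+y. \<phi> y * indicator {0<..} y \<partial>lborel) = emeasure (density lborel \<phi>) (\<Union>n. A n)"
    unfolding UnA by (simp add: emeasure_density)
  also have "\<dots> = (SUP n. emeasure (density lborel \<phi>) (A n))"
    by (rule SUP_emeasure_incseq[symmetric]) (auto simp: incA)
  also have "\<dots> = (SUP n. emeasure (density lborel (\<lambda>v. \<phi> (exp v) * ennreal (exp v))) (B n))"
    by (simp add: emeasure_density sub)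
  also have "\<dots> = emeasure (density lborel (\<lambda>v. \<phi> (exp v) * ennreal (exp v))) (\<Union>n. B n)"
    by (rule SUP_emeasure_incseq) (auto simp: incB)
  also have "\<dots> = (\<integral>\<^sup>+v. \<phi> (exp v) * ennreal (exp v) \<partial>lborel)"
    unfolding UnB by (simp add: emeasure_density)
  finally show ?thesis .
qed

lemma nn_integral_ln_substitution:
  fixes \<psi> :: "real \<Rightarrow> ennreal"
  assumes [measurable]: "\<psi> \<in> borel_measurable borel"
  shows "(\<integral>\<^sup>+u. \<psi> u \<partial>lborel) =
         (\<integral>\<^sup>+y. \<psi> (- ln y / 4) * ennreal (1 / (4 * y)) * indicator {0<..} y \<partial>lborel)"
proof -
  have "(\<integral>\<^sup>+y. \<psi> (- ln y / 4) * ennreal (1 / (4 * y)) * indicator {0<..} y \<partial>lborel) =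
        (\<integral>\<^sup>+v. \<psi> (- v / 4) * ennreal (1 / (4 * exp v)) * ennreal (exp v) \<partial>lborel)"
    by (subst nn_integral_exp_substitution) simp_all
  also have "\<dots> = (\<integral>\<^sup>+v. ennreal (1 / 4) * \<psi> (0 + (- 1 / 4) * v) \<partial>lborel)"
  proof (rule nn_integral_cong)
    fix v :: real
    have "ennreal (1 / (4 * exp v)) * ennreal (exp v) = ennreal (1 / 4)"
      by (subst ennreal_mult[symmetric]) auto
    then show "\<psi> (- v / 4) * ennreal (1 / (4 * exp v)) * ennreal (exp v) =
        ennreal (1 / 4) * \<psi> (0 + (- 1 / 4) * v)"
      by (simp add: mult.assoc) (simp add: mult.commute)
  qed
  also have "\<dots> = (\<integral>\<^sup>+u. \<psi> u \<partial>lborel)"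
    by (subst (2) nn_integral_real_affine[where c = "- 1 / 4" and t = 0]) (simp_all add: nn_integral_cmult)
  finally show ?thesis by simp
qed

text \<open>The inverse of \<open>(Te, Ti) \<mapsto> (Z, W)\<close>: with \<open>x = exp (- 4 Te)\<close> and \<open>y = exp (- 4 Ti)\<close> one has
  \<open>3 x = Z + 2 W\<close> and \<open>3 x y = Z - W\<close>.\<close>

definition branch_lengths :: "real \<times> real \<Rightarrow> real \<times> real" where
  "branch_lengths q =
     (- ln ((fst q + 2 * snd q) / 3) / 4, - ln ((fst q - snd q) / (fst q + 2 * snd q)) / 4)"

text \<open>The values of \<open>(Z, W)\<close> for which both logarithms above make sense, that is, the image of the whole
  plane; negative branch lengths are left to the density to exclude.\<close>

definition wedge :: "(real \<times> real) set" where
  "wedge = {q. 0 < fst q + 2 * snd q \<and> snd q < fst q}"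

text \<open>The modulus of the Jacobian determinant of \<open>branch_lengths\<close>, namely \<open>1 / (48 x\<^sup>2 y)\<close>.\<close>

definition jac :: "real \<times> real \<Rightarrow> real" where
  "jac q = 3 / (16 * (fst q + 2 * snd q) * (fst q - snd q))"

lemma open_wedge: "open wedge"
proof -
  have "wedge = {q. 0 < fst q + 2 * snd q} \<inter> {q. snd q < fst q}" by (auto simp: wedge_def)
  moreover have "open {q :: real \<times> real. 0 < fst q + 2 * snd q}" "open {q :: real \<times> real. snd q < fst q}"
    by (intro open_Collect_less continuous_intros)+
  ultimately show ?thesis by (metis open_Int)
qed

lemma wedge_measurable [measurable]: "wedge \<in> sets borel"
  using open_wedge by simp

lemma branch_lengths_measurable [measurable]: "branch_lengths \<in> borel_measurable borel"
  unfolding branch_lengths_def[abs_def] borel_prod[symmetric] by measurable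

lemma jac_measurable [measurable]: "jac \<in> borel_measurable borel"
  unfolding jac_def[abs_def] borel_prod[symmetric] by measurable

lemma Zstat_measurable [measurable]: "Zstat \<in> borel_measurable borel"
  unfolding Zstat_def[abs_def] borel_prod[symmetric] by measurable

lemma Wstat_measurable [measurable]: "Wstat \<in> borel_measurable borel"
  unfolding Wstat_def[abs_def] borel_prod[symmetric] by measurable

lemma stat_branch_lengths:
  assumes "q \<in> wedge"
  shows "Zstat (branch_lengths q) = fst q" and "Wstat (branch_lengths q) = snd q"
proof -
  obtain z w where q: "q = (z, w)" by force
  from assms have "0 < z + 2 * w" "w < z" by (auto simp: wedge_def q)
  then show "Zstat (branch_lengths q) = fst q" "Wstat (branch_lengths q) = snd q"
    by (simp_all add: Zstat_def Wstat_def branch_lengths_def q field_simps)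
qed

text \<open>The coordinate change is a composition of one-dimensional ones: both branch lengths go to \<open>x = exp (- 4 Te)\<close> and \<open>y = exp (- 4 Ti)\<close>
  by the logarithmic substitution; then, for fixed \<open>x\<close>, \<open>y\<close> goes to \<open>w = x (1 - y)\<close>, and for fixed
  \<open>w\<close>, \<open>x\<close> goes to \<open>z = 3 x - 2 w\<close>, both of which are affine. The order of integration is exchanged
  in between.\<close>

lemma nn_integral_branch_lengths:
  fixes F :: "real \<times> real \<Rightarrow> ennreal"
  assumes F: "F \<in> borel_measurable borel"
  shows "(\<integral>\<^sup>+p. F p \<partial>lborel) =
         (\<integral>\<^sup>+q. F (branch_lengths q) * ennreal (jac q) * indicator wedge q \<partial>lborel)"
proof -
  note swap = lborel_pair.Fubini'
  have [measurable]: "F \<in> borel_measurable (borel \<Otimes>\<^sub>M borel)" using F by (simp add: borel_prod)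
  \<comment> \<open>\<open>g\<close> and \<open>h\<close> are the integrand in the coordinates \<open>(x, y)\<close> and \<open>(z, w)\<close>; the factors \<open>1 / 3\<close> and
    \<open>1 / x\<close> in \<open>gh\<close> are the slopes, up to sign, of the two affine substitutions.\<close>
  define g where "g x y = F (- ln x / 4, - ln y / 4) * ennreal (1 / (4 * y)) * indicator {0<..} y
      * ennreal (1 / (4 * x)) * indicator {0<..} x" for x y :: real
  have [measurable]: "case_prod g \<in> borel_measurable (borel \<Otimes>\<^sub>M borel)"
    unfolding g_def by measurable
  define h where "h z w = F (branch_lengths (z, w)) * ennreal (jac (z, w)) * indicator wedge (z, w)"
    for z w :: real
  have [measurable]: "case_prod h \<in> borel_measurable (borel \<Otimes>\<^sub>M borel)"
  proof -
    have "case_prod h = (\<lambda>q. F (branch_lengths q) * ennreal (jac q) * indicator wedge q)"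
      by (auto simp: h_def)
    then show ?thesis using F by (simp add: borel_prod)
  qed
  have gh: "ennreal (1/3) * (ennreal (1/x) * g x (1 - w / x) * indicator {0<..} x) = h z w" if x: "x = (2 * w + z) / 3" for x w z
  proof (cases "(z, w) \<in> wedge")
    case True
    then have pos: "x > 0" "w < z" "w < x" by (auto simp: wedge_def x)
    then have y: "1 - w / x = (z - w) / (z + 2 * w)" "0 < 1 - w / x" by (auto simp: x field_simps)
    have eq: "1/3 * (1 / x) * (1 / (4 * (1 - w / x)) * (1 / (4 * x))) = jac (z, w)"
    proof -
      have "1/3 * (1 / x) * (1 / (4 * (1 - w / x)) * (1 / (4 * x))) = 1 / (48 * x * (x * (1 - w / x)))"
        by simp
      also have "x * (1 - w / x) = (z - w) / 3" using pos(1) by (simp add: right_diff_distrib) (simp add: x)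
      also have "1 / (48 * x * ((z - w) / 3)) = jac (z, w)"
      proof -
        have "48 * x = 16 * (z + 2 * w)" by (simp add: x)
        then show ?thesis by (simp only: jac_def fst_conv snd_conv) simp
      qed
      finally show ?thesis .
    qed
    have "F (- ln x / 4, - ln (1 - w / x) / 4) = F (branch_lengths (z, w))"
      unfolding branch_lengths_def fst_conv snd_conv y(1)
      by (simp only: x add.commute)
    moreover have "ennreal (1/3) * (ennreal (1/x) * (a * ennreal (1 / (4 * (1 - w / x))) * ennreal (1 / (4 * x))))
        = a * ennreal (jac (z, w))" for a
    proof -
      have "ennreal (r * s * (t * u)) = ennreal r * ennreal s * (ennreal t * ennreal u)"
        if "0 \<le> r" "0 \<le> s" "0 \<le> t" "0 \<le> u" for r s t u
        using that by (simp add: ennreal_mult)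
      from this[of "1/3" "1 / x" "1 / (4 * (1 - w / x))" "1 / (4 * x)"]
      have "ennreal (jac (z, w)) =
          ennreal (1/3) * ennreal (1 / x) * (ennreal (1 / (4 * (1 - w / x))) * ennreal (1 / (4 * x)))"
        unfolding eq using pos(1) y(2) by simp
      then show ?thesis by (simp only: ac_simps)
    qed
    ultimately show ?thesis using True pos y(2) unfolding g_def h_def by simp
  next
    case False
    then have "x \<le> 0 \<or> (x > 0 \<and> 1 - w / x \<le> 0)"
      by (auto simp: wedge_def x field_simps)
    then show ?thesis using False by (auto simp: h_def g_def)
  qed
  have "(\<integral>\<^sup>+p. F p \<partial>lborel) = (\<integral>\<^sup>+a. \<integral>\<^sup>+b. F (a, b) \<partial>lborel \<partial>lborel)"
    using F by (simp add: lborel.nn_integral_fst[symmetric] lborel_prod[symmetric] borel_prod)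
  also have "\<dots> = (\<integral>\<^sup>+a. \<integral>\<^sup>+y. F (a, - ln y / 4) * ennreal (1 / (4 * y)) * indicator {0<..} y \<partial>lborel \<partial>lborel)"
    by (subst nn_integral_ln_substitution) simp_all
  also have "\<dots> = (\<integral>\<^sup>+x. \<integral>\<^sup>+y. g x y \<partial>lborel \<partial>lborel)"
    unfolding g_def by (subst nn_integral_ln_substitution) (simp_all add: nn_integral_multc)
  also have "\<dots> = (\<integral>\<^sup>+x. \<integral>\<^sup>+w. ennreal (1/x) * g x (1 - w / x) * indicator {0<..} x \<partial>lborel \<partial>lborel)"
  proof (rule nn_integral_cong)
    fix x :: real
    show "(\<integral>\<^sup>+y. g x y \<partial>lborel) = (\<integral>\<^sup>+w. ennreal (1/x) * g x (1 - w / x) * indicator {0<..} x \<partial>lborel)"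
    proof (cases "x > 0")
      case True
      then show ?thesis
        by (subst nn_integral_real_affine[where c = "- (1 / x)" and t = 1])
           (simp_all add: nn_integral_cmult)
    qed (simp add: g_def)
  qed
  also have "\<dots> = (\<integral>\<^sup>+w. \<integral>\<^sup>+x. ennreal (1/x) * g x (1 - w / x) * indicator {0<..} x \<partial>lborel \<partial>lborel)"
    by (rule swap[symmetric]) measurable
  also have "\<dots> = (\<integral>\<^sup>+w. \<integral>\<^sup>+z. h z w \<partial>lborel \<partial>lborel)"
  proof (rule nn_integral_cong)
    fix w :: real
    let ?k = "\<lambda>x. ennreal (1/x) * g x (1 - w / x) * indicator {0<..} x"
    have "(\<integral>\<^sup>+x. ?k x \<partial>lborel) = ennreal (1/3) * (\<integral>\<^sup>+z. ?k (2 * w / 3 + (1/3) * z) \<partial>lborel)"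
      by (subst nn_integral_real_affine[where c = "1/3" and t = "2 * w / 3"]) simp_all
    also have "\<dots> = (\<integral>\<^sup>+z. ennreal (1/3) * ?k (2 * w / 3 + (1/3) * z) \<partial>lborel)"
      by (rule nn_integral_cmult[symmetric]) measurable
    also have "\<dots> = (\<integral>\<^sup>+z. h z w \<partial>lborel)"
      by (intro nn_integral_cong gh) simp
    finally show "(\<integral>\<^sup>+x. ?k x \<partial>lborel) = (\<integral>\<^sup>+z. h z w \<partial>lborel)" .
  qed
  also have "\<dots> = (\<integral>\<^sup>+z. \<integral>\<^sup>+w. h z w \<partial>lborel \<partial>lborel)"
    by (rule swap) measurable
  also have "\<dots> = (\<integral>\<^sup>+q. case_prod h q \<partial>lborel)"
    by (subst lborel_prod[symmetric], subst lborel.nn_integral_fst[symmetric]) simp_all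
  also have "\<dots> = (\<integral>\<^sup>+q. F (branch_lengths q) * ennreal (jac q) * indicator wedge q \<partial>lborel)"
    by (intro nn_integral_cong) (auto simp: h_def)
  finally show ?thesis .
qed

lemma distr_stats_density:
  fixes d :: "real \<times> real \<Rightarrow> ennreal"
  assumes [measurable]: "d \<in> borel_measurable borel"
  shows "distr (density lborel d) borel (\<lambda>p. (Zstat p, Wstat p)) =
         density lborel (\<lambda>q. d (branch_lengths q) * ennreal (jac q) * indicator wedge q)"
proof (rule measure_eqI)
  fix A assume "A \<in> sets (distr (density lborel d) borel (\<lambda>p. (Zstat p, Wstat p)))"
  then have A [measurable]: "A \<in> sets borel" by simp
  have [measurable]: "(\<lambda>p. (Zstat p, Wstat p)) \<in> borel_measurable borel" by measurable
  have "emeasure (distr (density lborel d) borel (\<lambda>p. (Zstat p, Wstat p))) A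
      = (\<integral>\<^sup>+q. indicator A q \<partial>distr (density lborel d) borel (\<lambda>p. (Zstat p, Wstat p)))"
    by simp
  also have "\<dots> = (\<integral>\<^sup>+p. indicator A (Zstat p, Wstat p) \<partial>density lborel d)"
    by (rule nn_integral_distr) simp_all
  also have "\<dots> = (\<integral>\<^sup>+p. d p * indicator A (Zstat p, Wstat p) \<partial>lborel)"
    by (rule nn_integral_density) simp_all
  also have "\<dots> = (\<integral>\<^sup>+q. d (branch_lengths q) * indicator A (Zstat (branch_lengths q), Wstat (branch_lengths q))
      * ennreal (jac q) * indicator wedge q \<partial>lborel)"
    by (subst nn_integral_branch_lengths) simp_all
  also have "\<dots> = (\<integral>\<^sup>+q. d (branch_lengths q) * ennreal (jac q) * indicator wedge q * indicator A q \<partial>lborel)"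
    by (intro nn_integral_cong) (auto simp: stat_branch_lengths split: split_indicator)
  also have "\<dots> = emeasure (density lborel (\<lambda>q. d (branch_lengths q) * ennreal (jac q) * indicator wedge q)) A"
    by (simp add: emeasure_density)
  finally show "emeasure (distr (density lborel d) borel (\<lambda>p. (Zstat p, Wstat p))) A = \<dots>" .
qed simp

section \<open>Conditional laws from a joint density\<close>

text \<open>The fallback \<open>return borel c\<close> is used where the total mass cannot be normalised. The place \<open>c\<close> of
  the point mass is a parameter so that it can be kept away from the values of interest.\<close>

definition cond_kernel :: "(real \<times> real \<Rightarrow> ennreal) \<Rightarrow> real \<Rightarrow> real \<Rightarrow> real measure" where
  "cond_kernel \<rho> c z =
     (let H = \<integral>\<^sup>+w. \<rho> (z, w) \<partial>lborel
      in if H = 0 \<or> H = \<infinity> then return borel c else density lborel (\<lambda>w. \<rho> (z, w) / H))"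

lemma emeasure_cond_kernel:
  assumes \<rho>: "\<rho> \<in> borel_measurable borel" and [measurable]: "B \<in> sets borel"
  shows "emeasure (cond_kernel \<rho> c z) B =
     (let H = \<integral>\<^sup>+w. \<rho> (z, w) \<partial>lborel
      in if H = 0 \<or> H = \<infinity> then indicator B c else (\<integral>\<^sup>+w. \<rho> (z, w) * indicator B w \<partial>lborel) / H)"
proof -
  have [measurable]: "\<rho> \<in> borel_measurable (borel \<Otimes>\<^sub>M borel)" using \<rho> by (simp add: borel_prod)
  have "(\<integral>\<^sup>+w. \<rho> (z, w) / H * indicator B w \<partial>lborel) =
      (\<integral>\<^sup>+w. \<rho> (z, w) * indicator B w \<partial>lborel) / H" for H
  proof -
    have "(\<integral>\<^sup>+w. \<rho> (z, w) / H * indicator B w \<partial>lborel) =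
        (\<integral>\<^sup>+w. \<rho> (z, w) * indicator B w / H \<partial>lborel)"
      by (simp add: divide_ennreal_def ac_simps)
    also have "\<dots> = (\<integral>\<^sup>+w. \<rho> (z, w) * indicator B w \<partial>lborel) / H"
      by (rule nn_integral_divide) measurable
    finally show ?thesis .
  qed
  then show ?thesis by (simp add: cond_kernel_def Let_def emeasure_density)
qed

text \<open>The total mass \<open>H\<close> is the density of \<open>Z\<close>, so it is finite almost everywhere, and it cancels
  against the normalisation. Where \<open>H\<close> vanishes, both sides of the disintegration do. Hence the
  fallback measure never contributes.\<close>

lemma regular_cond_distr_cond_kernel:
  fixes \<rho> :: "real \<times> real \<Rightarrow> ennreal"
  assumes "prob_space L"
    and [measurable]: "W \<in> borel_measurable L" "Z \<in> borel_measurable L"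
    and \<rho>: "\<rho> \<in> borel_measurable borel"
    and joint: "distr L borel (\<lambda>p. (Z p, W p)) = density lborel \<rho>"
  shows "regular_cond_distr L W Z (cond_kernel \<rho> c)"
proof -
  interpret prob_space L by fact
  have [measurable]: "\<rho> \<in> borel_measurable (borel \<Otimes>\<^sub>M borel)" using \<rho> by (simp add: borel_prod)
  define H where "H z = (\<integral>\<^sup>+w. \<rho> (z, w) \<partial>lborel)" for z
  have [measurable]: "H \<in> borel_measurable borel" unfolding H_def by measurable
  have K: "cond_kernel \<rho> c z = (if H z = 0 \<or> H z = \<infinity> then return borel c
      else density lborel (\<lambda>w. \<rho> (z, w) / H z))" for z
    by (simp add: cond_kernel_def H_def Let_def)
  have rect: "emeasure L {p \<in> space L. Z p \<in> A \<and> W p \<in> B} =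
      (\<integral>\<^sup>+z. indicator A z * (\<integral>\<^sup>+w. \<rho> (z, w) * indicator B w \<partial>lborel) \<partial>lborel)"
    if [measurable]: "A \<in> sets borel" "B \<in> sets borel" for A B
  proof -
    have [measurable]: "A \<times> B \<in> sets borel" by (simp add: borel_prod[symmetric])
    have "emeasure L {p \<in> space L. Z p \<in> A \<and> W p \<in> B} = emeasure (distr L borel (\<lambda>p. (Z p, W p))) (A \<times> B)"
      by (subst emeasure_distr) (auto simp: borel_prod[symmetric] intro!: arg_cong[where f = "emeasure L"])
    also have "\<dots> = (\<integral>\<^sup>+q. \<rho> q * indicator (A \<times> B) q \<partial>lborel)"
      using \<rho> by (simp add: joint emeasure_density)
    also have "\<dots> = (\<integral>\<^sup>+z. \<integral>\<^sup>+w. \<rho> (z, w) * indicator (A \<times> B) (z, w) \<partial>lborel \<partial>lborel)"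
      by (subst lborel_prod[symmetric], subst lborel.nn_integral_fst[symmetric]) simp_all
    also have "\<dots> = (\<integral>\<^sup>+z. indicator A z * (\<integral>\<^sup>+w. \<rho> (z, w) * indicator B w \<partial>lborel) \<partial>lborel)"
      by (subst nn_integral_cmult[symmetric]) (auto intro!: nn_integral_cong simp: indicator_times ac_simps)
    finally show ?thesis .
  qed
  have margin: "distr L borel Z = density lborel H"
  proof (rule measure_eqI)
    fix A assume "A \<in> sets (distr L borel Z)"
    then have [measurable]: "A \<in> sets borel" by simp
    have "emeasure (distr L borel Z) A = emeasure L {p \<in> space L. Z p \<in> A \<and> W p \<in> UNIV}"
      by (subst emeasure_distr) (auto intro!: arg_cong[where f = "emeasure L"])
    also have "\<dots> = emeasure (density lborel H) A"
      by (subst rect) (simp_all add: emeasure_density H_def mult.commute)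
    finally show "emeasure (distr L borel Z) A = emeasure (density lborel H) A" .
  qed simp
  have "(\<integral>\<^sup>+z. H z \<partial>lborel) = emeasure (distr L borel Z) UNIV"
    unfolding margin by (simp add: emeasure_density)
  also have "\<dots> = 1" by (subst emeasure_distr) (auto simp: emeasure_space_1)
  finally have "AE z in lborel. H z \<noteq> \<infinity>"
    by (intro nn_integral_PInf_AE) auto
  have sets_kernel: "sets (cond_kernel \<rho> c z) = sets borel" for z by (simp add: K)
  have prob: "prob_space (cond_kernel \<rho> c z)" for z
  proof (cases "H z = 0 \<or> H z = \<infinity>")
    case True
    then show ?thesis by (simp add: K prob_space_return)
  next
    case False
    have "(\<integral>\<^sup>+w. \<rho> (z, w) / H z \<partial>lborel) = H z / H z"
      unfolding H_def by (rule nn_integral_divide) measurable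
    then show ?thesis using False
      by (auto simp: K emeasure_density top.not_eq_extremum intro!: prob_spaceI)
  qed
  have em: "emeasure (cond_kernel \<rho> c z) B = (if H z = 0 \<or> H z = \<infinity> then indicator B c
      else (\<integral>\<^sup>+w. \<rho> (z, w) * indicator B w \<partial>lborel) / H z)"
    if [measurable]: "B \<in> sets borel" for B z
    unfolding emeasure_cond_kernel[OF \<rho> that] by (simp add: H_def Let_def)
  have "cond_kernel \<rho> c \<in> borel \<rightarrow>\<^sub>M prob_algebra borel"
  proof (intro measurable_prob_algebraI measurable_subprob_algebra)
    fix B :: "real set" assume [measurable]: "B \<in> sets borel"
    show "(\<lambda>z. emeasure (cond_kernel \<rho> c z) B) \<in> borel_measurable borel"
      unfolding em[OF \<open>B \<in> sets borel\<close>] by measurable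
  qed (use prob in \<open>auto intro: prob_space_imp_subprob_space simp: sets_kernel\<close>)
  moreover have "emeasure L {p \<in> space L. Z p \<in> A \<and> W p \<in> B} =
      (\<integral>\<^sup>+z\<in>A. emeasure (cond_kernel \<rho> c z) B \<partial>distr L borel Z)"
    if [measurable]: "A \<in> sets borel" "B \<in> sets borel" for A B
  proof -
    have [measurable]: "(\<lambda>z. emeasure (cond_kernel \<rho> c z) B) \<in> borel_measurable borel"
      unfolding em[OF that(2)] by measurable
    have "(\<integral>\<^sup>+z\<in>A. emeasure (cond_kernel \<rho> c z) B \<partial>distr L borel Z) =
        (\<integral>\<^sup>+z. H z * (emeasure (cond_kernel \<rho> c z) B * indicator A z) \<partial>lborel)"
      unfolding margin by (rule nn_integral_density) measurable
    also have "\<dots> = (\<integral>\<^sup>+z. indicator A z * (\<integral>\<^sup>+w. \<rho> (z, w) * indicator B w \<partial>lborel) \<partial>lborel)"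
    proof (rule nn_integral_cong_AE)
      show "AE z in lborel. H z * (emeasure (cond_kernel \<rho> c z) B * indicator A z) =
          indicator A z * (\<integral>\<^sup>+w. \<rho> (z, w) * indicator B w \<partial>lborel)"
        using \<open>AE z in lborel. H z \<noteq> \<infinity>\<close>
      proof eventually_elim
        case (elim z)
        show ?case
        proof (cases "H z = 0")
          case True
          have "(\<integral>\<^sup>+w. \<rho> (z, w) * indicator B w \<partial>lborel) \<le> H z"
            unfolding H_def by (intro nn_integral_mono) (auto split: split_indicator)
          with True show ?thesis by simp
        next
          case False
          then have "H z * (x / H z) = x" for x
            using elim by (simp add: ennreal_times_divide mult.commute[of "H z"] mult_divide_eq_ennreal)
          then show ?thesis using False elim
            by (auto simp: em[OF that(2)] split: split_indicator)
        qed
      qed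
    qed
    finally show ?thesis using rect[OF that] by simp
  qed
  ultimately show ?thesis by (simp add: regular_cond_distr_def)
qed

section \<open>Functions that are smooth along fibres\<close>

text \<open>Only derivatives in the second coordinate \<open>w\<close> matter for the expansion in \<open>s\<close>, but they have to be
  continuous in both coordinates to be bounded uniformly in \<open>z\<close>. The recursion lets closure
  properties be proved by induction on the order of differentiability.\<close>

primrec fibre_Ck :: "nat \<Rightarrow> (real \<times> real) set \<Rightarrow> (real \<times> real \<Rightarrow> real) \<Rightarrow> bool" where
  "fibre_Ck 0 U \<phi> \<longleftrightarrow> continuous_on U \<phi>"
| "fibre_Ck (Suc n) U \<phi> \<longleftrightarrow> continuous_on U \<phi> \<and>
     (\<exists>\<phi>'. (\<forall>(z, w)\<in>U. ((\<lambda>v. \<phi> (z, v)) has_real_derivative \<phi>' (z, w)) (at w)) \<and> fibre_Ck n U \<phi>')"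

lemma fibre_Ck_continuous: "fibre_Ck n U \<phi> \<Longrightarrow> continuous_on U \<phi>"
  by (cases n) auto

lemma fibre_Ck_SucD: "fibre_Ck (Suc n) U \<phi> \<Longrightarrow> fibre_Ck n U \<phi>"
  by (induction n arbitrary: \<phi>) (auto simp: fibre_Ck_continuous)

lemma fibre_Ck_SucI:
  assumes "continuous_on U \<phi>" "fibre_Ck n U \<phi>'"
    and "\<And>z w. (z, w) \<in> U \<Longrightarrow> ((\<lambda>v. \<phi> (z, v)) has_real_derivative \<phi>' (z, w)) (at w)"
  shows "fibre_Ck (Suc n) U \<phi>"
  using assms by auto

lemma fibre_Ck_SucE:
  assumes "fibre_Ck (Suc n) U \<phi>"
  obtains \<phi>' where "fibre_Ck n U \<phi>'"
    and "\<And>z w. (z, w) \<in> U \<Longrightarrow> ((\<lambda>v. \<phi> (z, v)) has_real_derivative \<phi>' (z, w)) (at w)"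
  using assms by auto

lemma fibre_Ck_const: "fibre_Ck n U (\<lambda>_. c)"
proof (induction n arbitrary: c)
  case (Suc n)
  show ?case by (rule fibre_Ck_SucI[OF _ Suc[of 0]]) auto
qed auto

lemma fibre_Ck_add:
  "fibre_Ck n U \<phi> \<Longrightarrow> fibre_Ck n U \<psi> \<Longrightarrow> fibre_Ck n U (\<lambda>q. \<phi> q + \<psi> q)"
proof (induction n arbitrary: \<phi> \<psi>)
  case (Suc n)
  obtain \<phi>' where 1: "fibre_Ck n U \<phi>'"
    "\<And>z w. (z, w) \<in> U \<Longrightarrow> ((\<lambda>v. \<phi> (z, v)) has_real_derivative \<phi>' (z, w)) (at w)"
    using fibre_Ck_SucE[OF Suc.prems(1)] by blast
  obtain \<psi>' where 2: "fibre_Ck n U \<psi>'"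
    "\<And>z w. (z, w) \<in> U \<Longrightarrow> ((\<lambda>v. \<psi> (z, v)) has_real_derivative \<psi>' (z, w)) (at w)"
    using fibre_Ck_SucE[OF Suc.prems(2)] by blast
  show ?case
    by (rule fibre_Ck_SucI[OF _ Suc.IH[OF 1(1) 2(1)]])
       (auto intro!: continuous_intros DERIV_add 1 2 Suc.prems[THEN fibre_Ck_continuous])
qed (auto intro: continuous_intros)

text \<open>By the product rule the derivative is again a sum of products of functions with one derivative
  less.\<close>

lemma fibre_Ck_mult:
  "fibre_Ck n U \<phi> \<Longrightarrow> fibre_Ck n U \<psi> \<Longrightarrow> fibre_Ck n U (\<lambda>q. \<phi> q * \<psi> q)"
proof (induction n arbitrary: \<phi> \<psi>)
  case (Suc n)
  obtain \<phi>' where 1: "fibre_Ck n U \<phi>'"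
    "\<And>z w. (z, w) \<in> U \<Longrightarrow> ((\<lambda>v. \<phi> (z, v)) has_real_derivative \<phi>' (z, w)) (at w)"
    using fibre_Ck_SucE[OF Suc.prems(1)] by blast
  obtain \<psi>' where 2: "fibre_Ck n U \<psi>'"
    "\<And>z w. (z, w) \<in> U \<Longrightarrow> ((\<lambda>v. \<psi> (z, v)) has_real_derivative \<psi>' (z, w)) (at w)"
    using fibre_Ck_SucE[OF Suc.prems(2)] by blast
  have "fibre_Ck n U (\<lambda>q. \<phi>' q * \<psi> q + \<psi>' q * \<phi> q)"
    by (intro fibre_Ck_add Suc.IH 1 2 Suc.prems[THEN fibre_Ck_SucD])
  then show ?case
    by (rule fibre_Ck_SucI[rotated])
       (auto intro!: continuous_intros DERIV_mult 1 2 Suc.prems[THEN fibre_Ck_continuous])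
qed (auto intro: continuous_intros)

text \<open>The derivative of \<open>r = 1 / (z + c w)\<close> is \<open>- c r\<^sup>2\<close>, a product of functions already known to be
  smooth to the lower order, so no formula for the higher derivatives is needed.\<close>

lemma fibre_Ck_inverse_linear:
  assumes nz: "\<And>z w. (z, w) \<in> U \<Longrightarrow> z + c * w \<noteq> 0"
  shows "fibre_Ck n U (\<lambda>q. 1 / (fst q + c * snd q))"
proof -
  let ?r = "\<lambda>q :: real \<times> real. 1 / (fst q + c * snd q)"
  have cont: "continuous_on U ?r" by (intro continuous_intros) (auto dest: nz)
  show ?thesis
  proof (induction n)
    case (Suc n)
    have "fibre_Ck n U (\<lambda>q. (- c) * (?r q * ?r q))"
      by (intro fibre_Ck_mult fibre_Ck_const Suc.IH)
    then show ?case
      by (rule fibre_Ck_SucI[OF cont])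
         (auto intro!: derivative_eq_intros dest: nz simp: field_simps power2_eq_square)
  qed (simp add: cont)
qed

lemma fibre_Ck_jac:
  assumes "V \<subseteq> wedge"
  shows "fibre_Ck n V jac"
proof -
  have "fibre_Ck n V (\<lambda>q. 3 / 16 * (1 / (fst q + 2 * snd q) * (1 / (fst q + (- 1) * snd q))))"
    using assms by (intro fibre_Ck_mult fibre_Ck_const fibre_Ck_inverse_linear) (auto simp: wedge_def)
  moreover have "3 / 16 * (1 / r * (1 / s)) = 3 / (16 * r * s)" for r s :: real by simp
  ultimately show ?thesis by (simp only: jac_def[abs_def] mult_minus1 add_uminus_conv_diff)
qed

lemma Ck_on_continuous: "Ck_on n U g \<Longrightarrow> continuous_on U g"
proof (cases n)
  case (Suc m)
  assume "Ck_on n U g"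
  then obtain D where "\<forall>x\<in>U. (g has_derivative D x) (at x)" by (auto simp: Suc)
  then show ?thesis
    by (meson has_derivative_at_withinI has_derivative_continuous_on)
qed simp

lemma continuous_on_branch_lengths: "continuous_on wedge branch_lengths"
proof -
  have "(fst q + 2 * snd q) / 3 \<noteq> 0" "fst q + 2 * snd q \<noteq> 0" "(fst q - snd q) / (fst q + 2 * snd q) \<noteq> 0"
    if "q \<in> wedge" for q
    using that by (auto simp: wedge_def)
  then show ?thesis
    unfolding branch_lengths_def[abs_def]
    by (intro continuous_intros) auto
qed

text \<open>The chain rule expresses the derivative of \<open>g \<circ> branch_lengths\<close> by compositions of the partial
  derivatives of \<open>g\<close> with \<open>branch_lengths\<close>, and by the derivatives \<open>a\<close> and \<open>b\<close> of the two branch lengths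
  in \<open>w\<close>. The latter are rational, so the induction closes without a smoothness theory for maps into
  the plane.\<close>

lemma fibre_Ck_compose_branch_lengths:
  assumes "V \<subseteq> wedge" and "branch_lengths ` V \<subseteq> U" and "Ck_on n U g"
  shows "fibre_Ck n V (\<lambda>q. g (branch_lengths q))"
  using assms(3)
proof (induction n arbitrary: g)
  case 0
  show ?case
    using continuous_on_compose2[OF Ck_on_continuous[OF 0]
        continuous_on_subset[OF continuous_on_branch_lengths assms(1)] assms(2)] by simp
next
  case (Suc n)
  from Suc.prems obtain D where
    D: "\<And>x. x \<in> U \<Longrightarrow> (g has_derivative D x) (at x)" and
    Ck: "\<And>b. b \<in> Basis \<Longrightarrow> Ck_on n U (\<lambda>x. D x b)" by auto
  let ?r = "\<lambda>q :: real \<times> real. 1 / (fst q + 2 * snd q)"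
  let ?s = "\<lambda>q :: real \<times> real. 1 / (fst q + (- 1) * snd q)"
  define a where "a q = (- 1 / 2) * ?r q" for q
  define b where "b q = (1 / 4) * ?s q + (1 / 2) * ?r q" for q
  have pos: "z + 2 * w > 0" "w < z" if "(z, w) \<in> V" for z w
    using that assms(1) by (auto simp: wedge_def)
  have fr: "fibre_Ck n V ?r" by (rule fibre_Ck_inverse_linear) (auto dest: pos)
  have fs: "fibre_Ck n V ?s" by (rule fibre_Ck_inverse_linear) (auto dest: pos)
  have fab: "fibre_Ck n V a" "fibre_Ck n V b"
    unfolding a_def[abs_def] b_def[abs_def]
    by (intro fibre_Ck_add fibre_Ck_mult fibre_Ck_const fr fs)+
  have "continuous_on V (\<lambda>q. g (branch_lengths q))"
    using continuous_on_compose2[OF Ck_on_continuous[OF Suc.prems]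
        continuous_on_subset[OF continuous_on_branch_lengths assms(1)] assms(2)] by simp
  moreover have "fibre_Ck n V
      (\<lambda>q. a q * D (branch_lengths q) (1, 0) + b q * D (branch_lengths q) (0, 1))"
    by (intro fibre_Ck_add fibre_Ck_mult fab Suc.IH Ck) (auto simp: Basis_prod_def)
  moreover have "((\<lambda>v. g (branch_lengths (z, v))) has_real_derivative
      a (z, w) * D (branch_lengths (z, w)) (1, 0) + b (z, w) * D (branch_lengths (z, w)) (0, 1)) (at w)"
    if q: "(z, w) \<in> V" for z w
  proof -
    note p = pos[OF q]
    have 1: "((\<lambda>v. - ln ((z + 2 * v) / 3) / 4) has_real_derivative a (z, w)) (at w)"
      using p by (auto intro!: derivative_eq_intros simp: a_def field_simps)
    \<comment> \<open>The logarithm of the quotient is split, which is valid on a neighbourhood of \<open>w\<close> only.\<close>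
    have "((\<lambda>v. - (ln (z - v) - ln (z + 2 * v)) / 4) has_real_derivative
        - (- (1 / (z - w)) - 2 * (1 / (z + 2 * w))) / 4) (at w)"
      using p by (auto intro!: derivative_eq_intros)
    also have "- (- (1 / (z - w)) - 2 * (1 / (z + 2 * w))) / 4 = b (z, w)"
    proof -
      have "- (- s - 2 * r) / 4 = 1 / 4 * s + 1 / 2 * r" for r s :: real by simp
      then show ?thesis by (simp only: b_def fst_conv snd_conv mult_minus1 add_uminus_conv_diff)
    qed
    moreover have "\<forall>\<^sub>F v in nhds w. - (ln (z - v) - ln (z + 2 * v)) / 4 = - ln ((z - v) / (z + 2 * v)) / 4"
    proof -
      have "open {v. v < z \<and> 0 < z + 2 * v}" by (intro open_Collect_conj open_Collect_less continuous_intros)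
      then have "\<forall>\<^sub>F v in nhds w. v \<in> {v. v < z \<and> 0 < z + 2 * v}"
        by (rule eventually_nhds_in_open) (use p in auto)
      then show ?thesis by eventually_elim (simp add: ln_div)
    qed
    ultimately have 2: "((\<lambda>v. - ln ((z - v) / (z + 2 * v)) / 4) has_real_derivative b (z, w)) (at w)"
      by (subst DERIV_cong_ev[OF refl _ refl, symmetric]) auto
    have bl: "((\<lambda>v. branch_lengths (z, v)) has_derivative (\<lambda>h. (a (z, w) * h, b (z, w) * h))) (at w)"
      unfolding branch_lengths_def fst_conv snd_conv
      using 1 2 by (intro has_derivative_Pair) (auto simp: has_field_derivative_def)
    have "branch_lengths (z, w) \<in> U" using assms(2) q by auto
    note D' = D[OF this]
    have lin: "D (branch_lengths (z, w)) (a (z, w) * h, b (z, w) * h) =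
      (a (z, w) * D (branch_lengths (z, w)) (1, 0) + b (z, w) * D (branch_lengths (z, w)) (0, 1)) * h" for h
    proof -
      interpret linear "D (branch_lengths (z, w))" using D' by (rule has_derivative_linear)
      have "(a (z, w) * h, b (z, w) * h) = (a (z, w) * h) *\<^sub>R (1, 0) + (b (z, w) * h) *\<^sub>R (0, 1)" by simp
      then have "D (branch_lengths (z, w)) (a (z, w) * h, b (z, w) * h) =
        (a (z, w) * h) *\<^sub>R D (branch_lengths (z, w)) (1, 0) + (b (z, w) * h) *\<^sub>R D (branch_lengths (z, w)) (0, 1)"
        by (simp only: add scale)
      then show ?thesis by (simp add: algebra_simps)
    qed
    show ?thesis
      using has_derivative_compose[OF bl D']
      by (simp add: has_field_derivative_def lin)
  qed
  ultimately show ?case by (rule fibre_Ck_SucI)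
qed

section \<open>Integrated Taylor expansion along fibres\<close>

text \<open>The successive derivatives in the form of one sequence, as Maclaurin's theorem wants them.\<close>

lemma fibre_Ck_derivatives:
  assumes "fibre_Ck n U \<phi>"
  obtains D where "D 0 = \<phi>" and "\<And>m. m \<le> n \<Longrightarrow> continuous_on U (D m)"
    and "\<And>m z w. m < n \<Longrightarrow> (z, w) \<in> U \<Longrightarrow>
           ((\<lambda>v. D m (z, v)) has_real_derivative D (Suc m) (z, w)) (at w)"
  using assms
proof (induction n arbitrary: \<phi> thesis)
  case 0
  then show ?case by (auto intro: "0.prems"(1)[of "\<lambda>_. \<phi>"])
next
  case (Suc n)
  obtain \<phi>' where \<phi>': "fibre_Ck n U \<phi>'"
    "\<And>z w. (z, w) \<in> U \<Longrightarrow> ((\<lambda>v. \<phi> (z, v)) has_real_derivative \<phi>' (z, w)) (at w)"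
    using fibre_Ck_SucE[OF Suc.prems(2)] by blast
  obtain D where D: "D 0 = \<phi>'" "\<And>m. m \<le> n \<Longrightarrow> continuous_on U (D m)"
    "\<And>m z w. m < n \<Longrightarrow> (z, w) \<in> U \<Longrightarrow> ((\<lambda>v. D m (z, v)) has_real_derivative D (Suc m) (z, w)) (at w)"
    using Suc.IH[OF _ \<phi>'(1)] by blast
  show ?case
    by (rule Suc.prems(1)[of "case_nat \<phi> D"])
       (use \<phi>' D Suc.prems(2) in \<open>auto split: nat.split simp: less_Suc_eq_0_disj\<close>)
qed

text \<open>Maclaurin's formula bounds the difference of \<open>\<phi>(z, \<cdot>)\<close> and its Taylor polynomial by
  \<open>C w\<^sup>n / n!\<close>, where \<open>C\<close> bounds the \<open>n\<close>-th derivative on the compact set \<open>I \<times> [0, s0]\<close> and hence does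
  not depend on \<open>z\<close>. Integrating over \<open>[0, s]\<close> raises every exponent by one.\<close>

lemma fibre_integral_expansion:
  fixes \<phi> :: "real \<times> real \<Rightarrow> real"
  assumes "fibre_Ck n U \<phi>" and "compact I" and "0 < s0" and sub: "I \<times> {0..s0} \<subseteq> U"
  obtains a \<kappa> where "\<And>m. m < n \<Longrightarrow> bounded (a m ` I)" and "0 < \<kappa>"
    and "\<And>z s. z \<in> I \<Longrightarrow> s \<in> {0..s0} \<Longrightarrow>
           \<bar>integral {0..s} (\<lambda>w. \<phi> (z, w)) - (\<Sum>m<n. a m z * s ^ Suc m)\<bar> \<le> \<kappa> * s ^ Suc n"
proof -
  obtain D where D0: "D 0 = \<phi>" and cont: "\<And>m. m \<le> n \<Longrightarrow> continuous_on U (D m)"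
    and der: "\<And>m z w. m < n \<Longrightarrow> (z, w) \<in> U \<Longrightarrow>
           ((\<lambda>v. D m (z, v)) has_real_derivative D (Suc m) (z, w)) (at w)"
    using fibre_Ck_derivatives[OF assms(1)] by blast
  have "compact (I \<times> {0..s0})" using assms(2) by (intro compact_Times) auto
  then have bdd: "bounded (D m ` (I \<times> {0..s0}))" if "m \<le> n" for m
    using compact_imp_bounded compact_continuous_image continuous_on_subset[OF cont[OF that] sub] by blast
  obtain C where C: "C > 0" "\<And>q. q \<in> I \<times> {0..s0} \<Longrightarrow> \<bar>D n q\<bar> \<le> C"
    using bdd[of n] unfolding bounded_pos by auto
  define a where "a m z = D m (z, 0) / fact m / real (Suc m)" for m z
  have "bounded (a m ` I)" if "m < n" for m
  proof -
    have "bounded ((\<lambda>x. (1 / (fact m * real (Suc m))) *\<^sub>R x) ` (D m ` (I \<times> {0..s0})))"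
      using that by (intro bounded_scaling bdd) simp
    then show ?thesis
      by (rule bounded_subset) (use assms(3) in \<open>force simp: a_def\<close>)
  qed
  moreover have "0 < C / fact n / real (Suc n)" using C(1) by simp
  moreover have "\<bar>integral {0..s} (\<lambda>w. \<phi> (z, w)) - (\<Sum>m<n. a m z * s ^ Suc m)\<bar> \<le> C / fact n / real (Suc n) * s ^ Suc n"
    if z: "z \<in> I" and s: "s \<in> {0..s0}" for z s
  proof -
    define T where "T w = (\<Sum>m<n. D m (z, 0) / fact m * w ^ m)" for w
    have T: "\<bar>\<phi> (z, w) - T w\<bar> \<le> C / fact n * w ^ n" if w: "w \<in> {0..s}" for w
    proof (cases "w = 0")
      case True
      show ?thesis
      proof (cases n)
        case 0
        then show ?thesis using C(2)[of "(z, 0)"] z assms(3) by (simp add: T_def D0 True)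
      next
        case (Suc k)
        have "(\<Sum>m<n. D m (z, 0) / fact m * 0 ^ m) = D 0 (z, 0)"
          unfolding Suc by (simp add: sum.lessThan_Suc_shift)
        then show ?thesis by (simp add: T_def True D0 Suc)
      qed
    next
      case False
      then have "0 < w" using w by auto
      moreover have "\<forall>m t. m < n \<and> 0 \<le> t \<and> t \<le> w \<longrightarrow>
          DERIV (\<lambda>v. D m (z, v)) t :> D (Suc m) (z, t)"
      proof (intro allI impI)
        fix m t assume m: "m < n \<and> 0 \<le> t \<and> t \<le> w"
        then have "(z, t) \<in> U" using sub z w s by auto
        with m show "DERIV (\<lambda>v. D m (z, v)) t :> D (Suc m) (z, t)" using der by blast
      qed
      ultimately obtain t where t: "0 < t" "t \<le> w" and
        eq: "\<phi> (z, w) = (\<Sum>m<n. D m (z, 0) / fact m * w ^ m) + D n (z, t) / fact n * w ^ n"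
        using Maclaurin2[of w "\<lambda>m v. D m (z, v)" "\<lambda>v. \<phi> (z, v)" n] D0 by blast
      have "\<bar>D n (z, t)\<bar> \<le> C" using C(2) z t w s by auto
      then show ?thesis using \<open>0 < w\<close>
        by (simp add: eq T_def abs_mult divide_right_mono mult_right_mono)
    qed
    have pow: "((\<lambda>w. c * w ^ m) has_integral (c / real (Suc m) * s ^ Suc m)) {0..s}" for c m
    proof -
      have "((\<lambda>w. c * w ^ m) has_integral (c / real (Suc m) * s ^ Suc m - c / real (Suc m) * 0 ^ Suc m)) {0..s}"
      proof (rule fundamental_theorem_of_calculus)
        show "((\<lambda>w. c / real (Suc m) * w ^ Suc m) has_vector_derivative c * x ^ m) (at x within {0..s})" for x
          unfolding has_real_derivative_iff_has_vector_derivative[symmetric]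
          by (rule derivative_eq_intros refl | simp)+
      qed (use s in auto)
      then show ?thesis by simp
    qed
    have int_T: "(T has_integral (\<Sum>m<n. a m z * s ^ Suc m)) {0..s}"
      unfolding T_def a_def by (intro has_integral_sum pow) auto
    have "continuous_on {0..s} (\<lambda>w. \<phi> (z, w))"
      by (rule continuous_on_compose2[OF fibre_Ck_continuous[OF assms(1)]])
         (use sub z s in \<open>auto intro!: continuous_intros\<close>)
    then have int: "(\<lambda>w. \<phi> (z, w)) integrable_on {0..s}" by (rule integrable_continuous_real)
    have int_diff: "(\<lambda>w. \<phi> (z, w) - T w) integrable_on {0..s}"
      by (intro integrable_diff int has_integral_integrable[OF int_T])
    have "norm (integral {0..s} (\<lambda>w. \<phi> (z, w) - T w)) \<le> integral {0..s} (\<lambda>w. C / fact n * w ^ n)"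
      by (rule integral_norm_bound_integral[OF int_diff has_integral_integrable[OF pow]])
         (simp only: real_norm_def T)
    also have "integral {0..s} (\<lambda>w. C / fact n * w ^ n) = C / fact n / real (Suc n) * s ^ Suc n"
      by (rule integral_unique[OF pow])
    also have "integral {0..s} (\<lambda>w. \<phi> (z, w) - T w) = integral {0..s} (\<lambda>w. \<phi> (z, w)) - (\<Sum>m<n. a m z * s ^ Suc m)"
      using int int_T by (simp add: integral_diff has_integral_integrable integral_unique)
    finally show ?thesis by simp
  qed
  ultimately show ?thesis by (rule that)
qed

section \<open>Lebesgue integrals of continuous functions on an interval\<close>

lemma nn_integral_interval:
  fixes f :: "real \<Rightarrow> real"
  assumes "continuous_on {a..b} f" and "\<And>x. x \<in> {a..b} \<Longrightarrow> 0 \<le> f x"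
  shows "(\<integral>\<^sup>+x. ennreal (f x) * indicator {a..b} x \<partial>lborel) = ennreal (integral {a..b} f)"
proof -
  have "(f has_integral integral {a..b} f) {a..b}"
    using integrable_continuous_real[OF assms(1)] by (rule integrable_integral)
  then have "((\<lambda>x. indicator {a..b} x *\<^sub>R f x) has_integral integral {a..b} f) UNIV"
  proof (subst (asm) has_integral_restrict_UNIV[symmetric])
    have "(\<lambda>x. indicator {a..b} x *\<^sub>R f x) = (\<lambda>x. if x \<in> {a..b} then f x else 0)"
      by (auto simp: indicator_def)
    then show "((\<lambda>x. if x \<in> {a..b} then f x else 0) has_integral integral {a..b} f) UNIV \<Longrightarrow> ?thesis"
      by simp
  qed
  moreover have "(\<lambda>x. indicator {a..b} x *\<^sub>R f x) \<in> borel_measurable borel"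
    by (rule borel_measurable_continuous_on_indicator[OF _ assms(1)]) simp
  ultimately have "(\<integral>\<^sup>+x. ennreal (indicator {a..b} x *\<^sub>R f x) \<partial>lborel) = ennreal (integral {a..b} f)"
    using assms(2) by (intro nn_integral_has_integral_lborel) (auto simp: indicator_def)
  moreover have "ennreal (indicator {a..b} x *\<^sub>R f x) = ennreal (f x) * indicator {a..b} x" for x
    by (simp split: split_indicator)
  ultimately show ?thesis by simp
qed

section \<open>The expansion condition for a fibrewise smooth joint density\<close>

lemma powr_Suc_eq_power: "0 \<le> (s::real) \<Longrightarrow> s powr (1 + real m) = s ^ Suc m"
  by (cases "s = 0") (simp_all add: powr_add powr_realpow)

lemma compact_positive_lower_bound:
  fixes f :: "'a::topological_space \<Rightarrow> real"
  assumes "compact K" "continuous_on K f" "\<And>x. x \<in> K \<Longrightarrow> 0 < f x"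
  obtains \<mu> where "0 < \<mu>" "\<And>x. x \<in> K \<Longrightarrow> \<mu> \<le> f x"
proof (cases "K = {}")
  case True
  then show ?thesis using that[of 1] by simp
next
  case False
  then obtain x where "x \<in> K" "\<forall>y\<in>K. f x \<le> f y"
    using continuous_attains_inf[OF assms(1) _ assms(2)] by blast
  then show ?thesis using that[of "f x"] assms(3) by blast
qed

text \<open>For finite \<open>H z\<close> the conditional distribution function is the quotient of the integral expanded in
  \<open>fibre_integral_expansion\<close> and \<open>H z\<close>. The mass \<open>H z\<close> is at least the minimum of \<open>\<phi>\<close> times \<open>s0\<close>, so
  the division keeps coefficients and error bounded. If \<open>H z\<close> is infinite, the conditional law is the
  point mass at \<open>c > s0\<close>, whose distribution function vanishes on \<open>[0, s0]\<close>; the coefficients are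
  then taken to be zero.\<close>

lemma expansion_condition_cond_kernel:
  fixes \<rho> :: "real \<times> real \<Rightarrow> ennreal" and \<phi> :: "real \<times> real \<Rightarrow> real" and t l :: real
  defines "J \<equiv> {4 * q0 t - 1 - l .. 4 * q0 t - 1 + l}"
  assumes \<rho>: "\<rho> \<in> borel_measurable borel" and \<phi>: "fibre_Ck 3 V \<phi>"
    and s0: "0 < s0" "s0 \<le> 1" "s0 < c" and l: "0 < l" "J \<subseteq> {0<..<3}"
    and sub: "J \<times> {0..s0} \<subseteq> V" and pos: "\<And>q. q \<in> J \<times> {0..s0} \<Longrightarrow> 0 < \<phi> q"
    and \<rho>\<phi>: "\<And>q. q \<in> J \<times> {0..s0} \<Longrightarrow> \<rho> q = ennreal (\<phi> q)"
    and \<rho>0: "\<And>z w. z \<in> J \<Longrightarrow> w < 0 \<Longrightarrow> \<rho> (z, w) = 0"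
  shows "expansion_condition (\<lambda>z s. measure (cond_kernel \<rho> c z) {..s}) t"
proof -
  have cJ: "compact J" by (simp add: J_def)
  obtain a \<kappa> where a: "\<And>m. m < 3 \<Longrightarrow> bounded (a m ` J)" and \<kappa>: "0 < \<kappa>"
    and exp: "\<And>z s. z \<in> J \<Longrightarrow> s \<in> {0..s0} \<Longrightarrow>
        \<bar>integral {0..s} (\<lambda>w. \<phi> (z, w)) - (\<Sum>m<3. a m z * s ^ Suc m)\<bar> \<le> \<kappa> * s ^ Suc 3"
    using fibre_integral_expansion[OF \<phi> cJ s0(1) sub] by blast
  have "compact (J \<times> {0..s0})" using cJ by (intro compact_Times) auto
  then obtain \<mu> where \<mu>: "0 < \<mu>" "\<And>q. q \<in> J \<times> {0..s0} \<Longrightarrow> \<mu> \<le> \<phi> q"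
    using compact_positive_lower_bound[OF _ continuous_on_subset[OF fibre_Ck_continuous[OF \<phi>] sub] pos]
    by blast
  define H where "H z = (\<integral>\<^sup>+w. \<rho> (z, w) \<partial>lborel)" for z
  define h where "h = \<mu> * s0"
  have h: "0 < h" using \<mu> s0 by (simp add: h_def)
  have part: "(\<integral>\<^sup>+w. \<rho> (z, w) * indicator {..s} w \<partial>lborel) = ennreal (integral {0..s} (\<lambda>w. \<phi> (z, w)))"
    if z: "z \<in> J" and s: "s \<in> {0..s0}" for z s
  proof -
    have "(\<integral>\<^sup>+w. \<rho> (z, w) * indicator {..s} w \<partial>lborel) =
        (\<integral>\<^sup>+w. ennreal (\<phi> (z, w)) * indicator {0..s} w \<partial>lborel)"
    proof (rule nn_integral_cong)
      fix w show "\<rho> (z, w) * indicator {..s} w = ennreal (\<phi> (z, w)) * indicator {0..s} w"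
        using \<rho>\<phi>[of "(z, w)"] \<rho>0[of z w] z s by (auto split: split_indicator)
    qed
    also have "\<dots> = ennreal (integral {0..s} (\<lambda>w. \<phi> (z, w)))"
    proof (rule nn_integral_interval)
      show "continuous_on {0..s} (\<lambda>w. \<phi> (z, w))"
        by (rule continuous_on_compose2[OF fibre_Ck_continuous[OF \<phi>]])
           (use sub z s in \<open>auto intro!: continuous_intros\<close>)
      show "0 \<le> \<phi> (z, w)" if "w \<in> {0..s}" for w
        using pos[of "(z, w)"] that z s by auto
    qed
    finally show ?thesis .
  qed
  have Hh: "ennreal h \<le> H z" if z: "z \<in> J" for z
  proof -
    have "ennreal h = (\<integral>\<^sup>+w. ennreal \<mu> * indicator {0..s0} w \<partial>lborel)"
      using \<mu> s0 by (simp add: nn_integral_cmult_indicator h_def ennreal_mult)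
    also have "\<dots> \<le> H z"
      unfolding H_def using \<mu>(2) \<rho>\<phi> z
      by (intro nn_integral_mono) (auto split: split_indicator intro: ennreal_leI)
    finally show ?thesis .
  qed
  define F where "F i z = (if H z = \<infinity> then 0 else a i z / enn2real (H z))" for i z
  have Hr: "H z = ennreal (enn2real (H z))" "h \<le> enn2real (H z)" if "z \<in> J" "H z \<noteq> \<infinity>" for z
  proof -
    show "H z = ennreal (enn2real (H z))" using that by (simp add: ennreal_enn2real_if)
    then show "h \<le> enn2real (H z)" using Hh[OF that(1)]
      by (metis enn2real_nonneg ennreal_le_iff)
  qed
  have bF: "bounded (F i ` J)" if i: "i < 3" for i
  proof -
    obtain b where b: "0 < b" "\<And>z. z \<in> J \<Longrightarrow> \<bar>a i z\<bar> \<le> b"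
      using a[OF i] unfolding bounded_pos by auto
    have "\<bar>F i z\<bar> \<le> b / h" if "z \<in> J" for z
    proof (cases "H z = \<infinity>")
      case True
      then show ?thesis using b h by (simp add: F_def)
    next
      case False
      then show ?thesis using b(1) b(2)[OF that] h Hr(2)[OF that False]
        by (auto simp: F_def abs_divide intro!: frac_le)
    qed
    then show ?thesis unfolding bounded_iff by auto
  qed
  have est: "\<bar>measure (cond_kernel \<rho> c z) {..s} - (\<Sum>i<3. F i z * s ^ Suc i)\<bar> \<le> \<kappa> / h * s ^ Suc 3"
    if z: "z \<in> J" and s: "s \<in> {0..s0}" for z s
  proof (cases "H z = \<infinity>")
    case True
    then have "emeasure (cond_kernel \<rho> c z) {..s} = 0"
      using s s0 by (subst emeasure_cond_kernel[OF \<rho>]) (auto simp: H_def)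
    then have "measure (cond_kernel \<rho> c z) {..s} = 0" by (simp add: measure_def)
    then show ?thesis using True \<kappa> h s by (simp add: F_def)
  next
    case False
    let ?r = "enn2real (H z)" and ?i = "integral {0..s} (\<lambda>w. \<phi> (z, w))"
    have r: "h \<le> ?r" "0 < ?r" using Hr[OF z False] h by auto
    have "0 \<le> ?i"
    proof (rule integral_nonneg)
      show "(\<lambda>w. \<phi> (z, w)) integrable_on {0..s}"
        by (intro integrable_continuous_real continuous_on_compose2[OF fibre_Ck_continuous[OF \<phi>]])
           (use sub z s in \<open>auto intro!: continuous_intros\<close>)
      show "0 \<le> \<phi> (z, w)" if "w \<in> {0..s}" for w
        using pos[of "(z, w)"] that z s by auto
    qed
    have "H z \<noteq> 0" using r by auto
    then have "emeasure (cond_kernel \<rho> c z) {..s} = ennreal ?i / H z"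
      using False by (subst emeasure_cond_kernel[OF \<rho>]) (simp_all add: H_def[symmetric] part[OF z s] Let_def)
    also have "\<dots> = ennreal (?i / ?r)"
      by (subst Hr(1)[OF z False]) (rule divide_ennreal[OF \<open>0 \<le> ?i\<close> r(2)])
    finally have m: "measure (cond_kernel \<rho> c z) {..s} = ?i / ?r"
      using \<open>0 \<le> ?i\<close> r by (simp add: measure_def)
    have "measure (cond_kernel \<rho> c z) {..s} - (\<Sum>i<3. F i z * s ^ Suc i) =
        (?i - (\<Sum>i<3. a i z * s ^ Suc i)) / ?r"
      unfolding m using False by (simp add: F_def diff_divide_distrib sum_divide_distrib)
    also have "\<bar>\<dots>\<bar> \<le> \<kappa> * s ^ Suc 3 / h"
      unfolding abs_divide using exp[OF z s] r h \<kappa> s by (intro frac_le) auto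
    finally show ?thesis by simp
  qed
  show ?thesis
    unfolding expansion_condition_def
  proof (rule exI[of _ s0], rule exI[of _ l], rule exI[of _ 3], rule exI[of _ 1], rule exI[of _ "\<kappa> / h"],
      rule exI[of _ real], rule exI[of _ F], fold J_def, intro conjI)
    show "\<forall>s\<in>{0..s0}. \<forall>z\<in>J. \<bar>measure (cond_kernel \<rho> c z) {..s} - (\<Sum>i<3. F i z * s powr (1 + real i))\<bar>
        \<le> \<kappa> / h * s powr (1 + real 3)"
    proof (intro ballI)
      fix s z assume "s \<in> {0..s0}" "z \<in> J"
      moreover from this have "0 \<le> s" by simp
      ultimately show "\<bar>measure (cond_kernel \<rho> c z) {..s} - (\<Sum>i<3. F i z * s powr (1 + real i))\<bar>
        \<le> \<kappa> / h * s powr (1 + real 3)"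
        using est by (simp only: powr_Suc_eq_power)
    qed
  qed (use s0 l bF \<kappa> h in auto)
qed

section \<open>The logarithmic condition\<close>

text \<open>The event has Lebesgue measure of order \<open>1 / n\<^sup>2\<close>, and a density bounded below turns this into a
  polynomial lower bound of its probability, whose logarithm is \<open>o(n)\<close>.\<close>

lemma Q_subexponential:
  fixes d :: "real \<times> real \<Rightarrow> ennreal"
  assumes [measurable]: "d \<in> borel_measurable borel" and "prob_space (density lborel d)"
    and c: "0 < c" "\<And>p. p \<in> {t..t + 1} \<times> {0..1} \<Longrightarrow> ennreal c \<le> d p"
  shows "\<forall>\<^sub>F n in sequentially. 0 < Q (density lborel d) n t"
    and "(\<lambda>n. ln (Q (density lborel d) n t) / real n) \<longlonglongrightarrow> 0"
proof -
  interpret prob_space "density lborel d" by fact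
  let ?L = "density lborel d"
  have lower: "c / real n ^ 2 \<le> Q ?L n t" if n: "n \<ge> 1" for n
  proof -
    let ?A = "{p :: real \<times> real. snd p \<le> 1 / real n \<and> t \<le> fst p \<and> fst p \<le> t + 1 / real n}"
    let ?B = "{t..t + 1 / real n} \<times> {0..1 / real n}"
    have n1: "1 / real n \<le> 1" using n by simp
    have "closed ?A" "closed ?B"
      by (intro closed_Collect_conj closed_Collect_le closed_Times continuous_intros closed_atLeastAtMost)+
    then have [measurable]: "?A \<in> sets borel" "?B \<in> sets borel"
      by (auto intro: borel_closed)
    have B: "emeasure lborel ?B = ennreal (1 / real n) * ennreal (1 / real n)"
      unfolding lborel_prod[symmetric] by (subst lborel.emeasure_pair_measure_Times) auto
    have "ennreal (c / real n ^ 2) = ennreal c * emeasure lborel ?B"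
      unfolding B using c(1) by (simp add: ennreal_mult[symmetric] power2_eq_square)
    also have "\<dots> = (\<integral>\<^sup>+p. ennreal c * indicator ?B p \<partial>lborel)"
      by (rule nn_integral_cmult_indicator[symmetric]) simp
    also have "\<dots> \<le> (\<integral>\<^sup>+p. d p * indicator ?A p \<partial>lborel)"
      using n1 by (intro nn_integral_mono) (auto split: split_indicator intro!: c(2))
    also have "\<dots> = emeasure ?L ?A" by (simp add: emeasure_density)
    also have "\<dots> = ennreal (Q ?L n t)" by (simp add: Q_def emeasure_eq_measure)
    finally show ?thesis by (simp add: Q_def)
  qed
  have pos: "0 < Q ?L n t" if "n \<ge> 1" for n
    by (rule less_le_trans[OF _ lower[OF that]]) (use c(1) that in simp)
  then show "\<forall>\<^sub>F n in sequentially. 0 < Q ?L n t"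
    by (auto simp: eventually_sequentially)
  show "(\<lambda>n. ln (Q ?L n t) / real n) \<longlonglongrightarrow> 0"
  proof (rule tendsto_sandwich)
    show "\<forall>\<^sub>F n in sequentially. ln (c / real n ^ 2) / real n \<le> ln (Q ?L n t) / real n"
      using eventually_ge_at_top[of 1]
    proof eventually_elim
      case (elim n)
      then show ?case using lower[OF elim] pos[OF elim] c(1)
        by (intro divide_right_mono) (auto simp: ln_le_cancel_iff)
    qed
    show "\<forall>\<^sub>F n in sequentially. ln (Q ?L n t) / real n \<le> 0"
      using eventually_ge_at_top[of 1]
    proof eventually_elim
      case (elim n)
      have "Q ?L n t \<le> 1" unfolding Q_def by (rule prob_le_1)
      then show ?case using pos[OF elim] by (simp add: divide_nonpos_nonneg)
    qed
    show "(\<lambda>n. ln (c / real n ^ 2) / real n) \<longlonglongrightarrow> 0" using c(1) by real_asymp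
  qed simp
qed

section \<open>Temperedness\<close>

theorem proposition2p5:
  fixes M :: "'a measure" and Te Ti :: "'a \<Rightarrow> real" and f :: "real \<times> real \<Rightarrow> real"
  assumes "prob_space M"
    and "Te \<in> borel_measurable M" and "Ti \<in> borel_measurable M"
    and "AE \<omega> in M. 0 < Te \<omega> \<and> 0 < Ti \<omega>"
    and "distributed M lborel (\<lambda>\<omega>. (Te \<omega>, Ti \<omega>))
           (\<lambda>p. ennreal (f p * indicator ({0<..} \<times> {0..}) p))"
    and "smooth_on ({0<..} \<times> {0..}) f"
    and "bounded (f ` ({0<..} \<times> {0..}))"
    and "\<And>p. p \<in> {0<..} \<times> {0..} \<Longrightarrow> 0 < f p"
  shows "tempered (distr M borel (\<lambda>\<omega>. (Te \<omega>, Ti \<omega>)))"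
proof -
  interpret M: prob_space M by fact
  define S :: "(real \<times> real) set" where "S = {0<..} \<times> {0..}"
  define d where "d p = ennreal (f p * indicator S p)" for p
  define L where "L = distr M borel (\<lambda>\<omega>. (Te \<omega>, Ti \<omega>))"
  note f_pos = assms(8)[folded S_def]
  have d [measurable]: "d \<in> borel_measurable borel" and meas: "(\<lambda>\<omega>. (Te \<omega>, Ti \<omega>)) \<in> M \<rightarrow>\<^sub>M borel"
    and "distr M lborel (\<lambda>\<omega>. (Te \<omega>, Ti \<omega>)) = density lborel d"
    using assms(5) by (auto simp: distributed_def d_def[abs_def] S_def)
  moreover have "L = distr M lborel (\<lambda>\<omega>. (Te \<omega>, Ti \<omega>))"
    unfolding L_def by (rule distr_cong) simp_all
  ultimately have L: "L = density lborel d" by simp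
  have prob: "prob_space (density lborel d)"
    unfolding L[symmetric] L_def using meas by (rule M.prob_space_distr)
  obtain U g where U: "S \<subseteq> U" "\<And>n. Ck_on n U g" and fg: "\<And>p. p \<in> S \<Longrightarrow> f p = g p"
    using assms(6) unfolding smooth_on_def S_def by blast
  define \<rho> where "\<rho> q = d (branch_lengths q) * ennreal (jac q) * indicator wedge q" for q
  have \<rho>: "\<rho> \<in> borel_measurable borel" unfolding \<rho>_def[abs_def] by measurable
  define V where "V = wedge \<inter> branch_lengths -` U"
  define \<phi> where "\<phi> q = g (branch_lengths q) * jac q" for q
  have \<phi>: "fibre_Ck n V \<phi>" for n
    unfolding \<phi>_def[abs_def] V_def
    by (intro fibre_Ck_mult fibre_Ck_jac fibre_Ck_compose_branch_lengths[OF _ _ U(2)]) auto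

  \<comment> \<open>\<open>W < 1\<close>, so a point mass at \<open>2\<close> does not interfere with the expansion for \<open>s \<le> 1\<close>.\<close>
  have "regular_cond_distr L Wstat Zstat (cond_kernel \<rho> 2)"
    unfolding L
    by (rule regular_cond_distr_cond_kernel[OF prob _ _ \<rho>])
       (simp_all add: distr_stats_density \<rho>_def[abs_def])
  moreover have "expansion_condition (\<lambda>z s. measure (cond_kernel \<rho> 2 z) {..s}) t" if "t > 0" for t
  proof -
    define z0 where "z0 = 4 * q0 t - 1"
    have z0: "z0 = 3 * exp (- 4 * t)" by (simp add: z0_def q0_def add_divide_distrib)
    have "0 < z0" "z0 < 3" using that by (simp_all add: z0)
    \<comment> \<open>The choice of \<open>l\<close> keeps \<open>w < z\<close> and \<open>z + 2 w < 3\<close>, that is, \<open>Ti\<close> finite and \<open>Te > 0\<close>, on the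
      rectangle \<open>[z0 - l, z0 + l] \<times> [0, l]\<close>.\<close>
    define l where "l = min z0 (3 - z0) / 4"
    have l: "0 < l" "4 * l \<le> z0" "4 * l \<le> 3 - z0" "l \<le> 1"
      using \<open>0 < z0\<close> \<open>z0 < 3\<close> by (auto simp: l_def)
    have wedge: "(z, w) \<in> wedge \<and> branch_lengths (z, w) \<in> S \<and> 0 < jac (z, w)"
      if "z \<in> {z0 - l..z0 + l}" "w \<in> {0..l}" for z w
    proof -
      have zw: "0 < z - w" "0 \<le> w" "0 < z + 2 * w" "z + 2 * w < 3" using that l by auto
      have "ln ((z + 2 * w) / 3) < 0" "ln ((z - w) / (z + 2 * w)) \<le> 0" using zw by simp_all
      then show ?thesis using zw by (simp add: wedge_def branch_lengths_def S_def jac_def)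
    qed
    have Ti_neg: "branch_lengths (z, w) \<notin> S" if "(z, w) \<in> wedge" "w < 0" for z w
    proof -
      have "1 < (z - w) / (z + 2 * w)" using that by (simp add: wedge_def)
      then have "0 < ln ((z - w) / (z + 2 * w))" by simp
      then show ?thesis by (simp add: branch_lengths_def S_def)
    qed
    show ?thesis
    proof (rule expansion_condition_cond_kernel[OF \<rho> \<phi>, where l = l and ?s0.0 = l and t = t, folded z0_def])
      show "{z0 - l..z0 + l} \<subseteq> {0<..<3}" using l by auto
      show "{z0 - l..z0 + l} \<times> {0..l} \<subseteq> V"
        unfolding V_def using wedge U(1) by blast
      show "0 < \<phi> q" if "q \<in> {z0 - l..z0 + l} \<times> {0..l}" for q
        using that wedge f_pos fg by (cases q) (auto simp: \<phi>_def)
      show "\<rho> q = ennreal (\<phi> q)" if "q \<in> {z0 - l..z0 + l} \<times> {0..l}" for q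
      proof -
        have q: "q \<in> wedge" "branch_lengths q \<in> S" "0 < jac q" using that wedge by (cases q; auto)+
        then show ?thesis using f_pos[OF q(2)] fg[OF q(2)]
          by (simp add: \<rho>_def \<phi>_def d_def ennreal_mult)
      qed
      show "\<rho> (z, w) = 0" if "w < 0" for z w
        using Ti_neg[of z w] that by (auto simp: \<rho>_def d_def split: split_indicator)
    qed (use l in auto)
  qed
  moreover have "(\<forall>\<^sub>F n in sequentially. 0 < Q L n t) \<and> (\<lambda>n. ln (Q L n t) / real n) \<longlonglongrightarrow> 0" if "t > 0" for t
  proof -
    let ?K = "{t..t + 1} \<times> {0..1::real}"
    have KS: "?K \<subseteq> S" using that by (auto simp: S_def)
    have "compact ?K" by (intro compact_Times) auto
    moreover have "continuous_on ?K g"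
      by (rule continuous_on_subset[OF Ck_on_continuous[OF U(2)[of 0]]]) (use KS U(1) in blast)
    moreover have "0 < g p" if "p \<in> ?K" for p
      using f_pos[of p] fg[of p] KS that by auto
    ultimately obtain c where c: "0 < c" "\<And>p. p \<in> ?K \<Longrightarrow> c \<le> g p"
      using compact_positive_lower_bound by blast
    have "ennreal c \<le> d p" if "p \<in> ?K" for p
    proof -
      have "p \<in> S" using KS that by blast
      then show ?thesis using c(2)[OF that] fg by (simp add: d_def ennreal_leI)
    qed
    then show ?thesis unfolding L using Q_subexponential[OF d prob c(1)] by blast
  qed
  ultimately show ?thesis unfolding tempered_def L_def[symmetric] by blast
qed

end
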